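(* Consider the batch sizes $N_i=\min\bigl\{\lceil T^{1-a^i}\rceil,\;T-\sum_{j=1}^{i-1}N_j\bigr\}$, where $a\in(0,1)$ and $i\in\{1,\dots,B\}$. Then $B=(\log_{1/a}\log T)(1+o(1))$. Specifically, $$B\le\lceil\log_{1/a}\log_2T\rceil+1,\qquad B\ge\Bigl\lfloor\log_{1/a}\Bigl(\frac{\log T}{\log\log T}\Bigr)\Bigr\rfloor.$$
   Context: $T$ is an integer time horizon, which is split into $B$ consecutive batches of positive sizes $N_1,\dots,N_B$ with $\sum_{i=1}^B N_i=T$, and $T\ge B\ge 2$. Here $B$ is not given in advance: it is the exact number of batches needed for the stated choice of sizes, i.e. the smallest integer with $\sum_{i=1}^B N_i=T$. The parameter $a$ is a fixed constant, and $o(1)$ refers to $T\to\infty$. $\log$ denotes the natural logarithm and $\log_b$ the logarithm in base $b$.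
   Formalization: The lower bound on B is proved for all sufficiently large T (threshold depending on the fixed a), since it fails for small T: for T=3, a=1/2 the sizes are 2, 1, so B=2, while the stated lower bound is 3. *)

theory Defs
  imports Complex_Main "HOL-Library.Landau_Symbols"
begin

text \<open>The sizes are integers, so that the subtraction is not truncated.  The formula is used for all
  \<open>i \<ge> 1\<close>: once the batches exhaust \<open>T\<close>, all further sizes are \<open>0\<close>.\<close>

fun batch_size :: "real \<Rightarrow> nat \<Rightarrow> nat \<Rightarrow> int" where
  "batch_size a T i =
     min \<lceil>real T powr (1 - a ^ i)\<rceil> (int T - (\<Sum>j\<in>{1..<i}. batch_size a T j))"

declare batch_size.simps [simp del]

definition num_batches :: "real \<Rightarrow> nat \<Rightarrow> nat" where
  "num_batches a T = (LEAST B. (\<Sum>i\<in>{1..B}. batch_size a T i) = int T)"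

lemma sum_batch_size_Suc:
  "(\<Sum>i\<in>{1..Suc n}. batch_size a T i) =
     min ((\<Sum>i\<in>{1..n}. batch_size a T i) + \<lceil>real T powr (1 - a ^ Suc n)\<rceil>) (int T)"
proof -
  have "{1..<Suc n} = {1..n}" by auto
  then show ?thesis
    using batch_size.simps[of a T "Suc n"] by auto
qed

lemma sum_batch_size_le: "(\<Sum>i\<in>{1..n}. batch_size a T i) \<le> int T"
proof (cases n)
  case (Suc m)
  then show ?thesis using sum_batch_size_Suc[of a T m] by simp
qed simp

lemma sum_batch_size_ge:
  assumes "T > 0"
  shows "(\<Sum>i\<in>{1..n}. batch_size a T i) \<ge> min (int n) (int T)"
proof (induction n)
  case (Suc n)
  have "\<lceil>real T powr (1 - a ^ Suc n)\<rceil> \<ge> 1"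
    using assms by (simp add: one_le_ceiling)
  then show ?case
    using Suc unfolding sum_batch_size_Suc by linarith
qed simp

text \<open>The minimum defining \<^const>\<open>num_batches\<close> is attained, the batches up to it have positive
  sizes, and there are at most \<open>T\<close> of them.\<close>

lemma sum_batch_size_num_batches:
  assumes "T > 0"
  shows "(\<Sum>i\<in>{1..num_batches a T}. batch_size a T i) = int T"
proof -
  have "(\<Sum>i\<in>{1..T}. batch_size a T i) = int T"
    using sum_batch_size_ge[OF assms, of T a] sum_batch_size_le[of a T T] by simp
  then show ?thesis
    unfolding num_batches_def by (rule LeastI)
qed

lemma num_batches_le:
  assumes "T > 0"
  shows "num_batches a T \<le> T"
  unfolding num_batches_def
  using sum_batch_size_ge[OF assms, of T a] sum_batch_size_le[of a T T]
  by (intro Least_le) simp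

lemma batch_size_pos:
  assumes "T > 0" "i \<in> {1..num_batches a T}"
  shows "batch_size a T i > 0"
proof -
  obtain m where m: "i = Suc m" "m < num_batches a T"
    using assms(2) by (cases i) auto
  have "(\<Sum>j\<in>{1..m}. batch_size a T j) \<noteq> int T"
    using m(2) not_less_Least unfolding num_batches_def by blast
  then have "(\<Sum>j\<in>{1..m}. batch_size a T j) < int T"
    using sum_batch_size_le[of a T m] by linarith
  moreover have "\<lceil>real T powr (1 - a ^ i)\<rceil> > 0"
    using assms(1) by simp
  moreover have "{1..<i} = {1..m}"
    using m(1) by auto
  ultimately show ?thesis
    by (simp add: batch_size.simps[of a T i])
qed

end

theory Submission
  imports Defs "HOL-Real_Asymp.Real_Asymp"
begin

text \<open>Write \<open>c i = \<lceil>T powr (1 - a ^ i)\<rceil>\<close>, so that \<open>num_batches a T\<close> is the least \<open>n\<close> with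
  \<open>c 1 + \<dots> + c n \<ge> T\<close>.  For \<open>K = \<lceil>log (1 / a) (log 2 T)\<rceil>\<close> we have \<open>T powr (a ^ K) \<le> 2\<close>, so \<open>c K\<close>
  and \<open>c (K + 1)\<close> are each at least \<open>T / 2\<close> and \<open>K + 1\<close> batches suffice.  Conversely, while
  \<open>a ^ i \<ge> ln (ln T) / ln T\<close> we have \<open>T powr (a ^ i) \<ge> ln T\<close> and hence \<open>c i \<le> T / ln T + 1\<close>;
  there are only \<open>O(ln (ln T))\<close> such \<open>i\<close>, so their batches cannot exhaust \<open>T\<close>.\<close>

text \<open>The rounded powers are nonnegative, so a partial sum that has reached the cap
  \<open>T\<close> stays there. Capping each step is therefore the same as capping the total once,
  and both bounds can work with plain sums of ceilings.\<close>

lemma sum_batch_size_eq_min: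
  "(\<Sum>i\<in>{1..n}. batch_size a T i) = min (\<Sum>i\<in>{1..n}. \<lceil>real T powr (1 - a ^ i)\<rceil>) (int T)"
proof (induction n)
  case (Suc n)
  have "0 \<le> \<lceil>real T powr (1 - a ^ Suc n)\<rceil>"
    using powr_ge_zero[of "real T" "1 - a ^ Suc n"] by linarith
  moreover have "(\<Sum>i\<in>{1..Suc n}. \<lceil>real T powr (1 - a ^ i)\<rceil>) =
      (\<Sum>i\<in>{1..n}. \<lceil>real T powr (1 - a ^ i)\<rceil>) + \<lceil>real T powr (1 - a ^ Suc n)\<rceil>"
    by simp
  ultimately show ?case
    unfolding sum_batch_size_Suc Suc.IH by linarith
qed simp

lemma num_batches_le_if:
  assumes "int T \<le> (\<Sum>i\<in>{1..n}. \<lceil>real T powr (1 - a ^ i)\<rceil>)"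
  shows "num_batches a T \<le> n"
  unfolding num_batches_def
  by (rule Least_le) (use assms in \<open>simp only: sum_batch_size_eq_min min_absorb2\<close>)

lemma le_sum_num_batches:
  assumes "T > 0"
  shows "int T \<le> (\<Sum>i\<in>{1..num_batches a T}. \<lceil>real T powr (1 - a ^ i)\<rceil>)"
  using sum_batch_size_num_batches[OF assms, of a] unfolding sum_batch_size_eq_min by linarith

context
  fixes a :: real
  assumes a: "0 < a" "a < 1"
begin

text \<open>As \<open>1 / a > 1\<close>, the logarithm to this base is increasing. This and the next
  lemma turn bounds on an index into bounds on \<open>a ^ n\<close>, the quantity in the exponents
  of the batch sizes.\<close>

lemma log_inverse_le_iff:
  assumes "x > 0"
  shows "log (1 / a) x \<le> real n \<longleftrightarrow> a ^ n * x \<le> 1"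
proof -
  have "log (1 / a) x \<le> real n \<longleftrightarrow> x \<le> (1 / a) ^ n"
    using a assms by (simp add: log_le_iff powr_realpow)
  also have "\<dots> \<longleftrightarrow> a ^ n * x \<le> 1"
    using a by (simp add: power_one_over field_simps)
  finally show ?thesis .
qed

lemma le_log_inverse_iff:
  assumes "x > 0"
  shows "real n \<le> log (1 / a) x \<longleftrightarrow> 1 \<le> a ^ n * x"
proof -
  have "real n \<le> log (1 / a) x \<longleftrightarrow> (1 / a) ^ n \<le> x"
    using a assms by (simp add: le_log_iff powr_realpow)
  also have "\<dots> \<longleftrightarrow> 1 \<le> a ^ n * x"
    using a by (simp add: power_one_over field_simps)
  finally show ?thesis .
qed

lemma num_batches_upper:
  assumes T: "T \<ge> 2"
  shows "int (num_batches a T) \<le> \<lceil>log (1 / a) (log 2 (real T))\<rceil> + 1"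
proof -
  have log2: "log 2 (real T) \<ge> 1"
    using T by simp
  then have ge0: "log (1 / a) (log 2 (real T)) \<ge> 0"
    using a by simp
  define K where "K = nat \<lceil>log (1 / a) (log 2 (real T))\<rceil>"
  have K: "int K = \<lceil>log (1 / a) (log 2 (real T))\<rceil>"
    unfolding K_def using ge0 by simp
  have "int T \<le> (\<Sum>i\<in>{1..Suc K}. \<lceil>real T powr (1 - a ^ i)\<rceil>)"
  proof (cases K)
    case 0
    then have "log (1 / a) (log 2 (real T)) \<le> real 0"
      using K by linarith
    then have "log 2 (real T) \<le> 1"
      using log_inverse_le_iff[of "log 2 (real T)" 0] log2 by simp
    then have "T = 2"
      using T by (simp add: log_le_iff)
    moreover have "(2::real) powr (1 - a) > 1"
      using a by simp
    then have "\<lceil>(2::real) powr (1 - a)\<rceil> \<ge> 2"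
      by linarith
    ultimately show ?thesis
      using 0 by simp
  next
    case (Suc k)
    have half: "real T / 2 \<le> \<lceil>real T powr (1 - a ^ i)\<rceil>" if "i \<ge> K" for i
    proof -
      have "log (1 / a) (log 2 (real T)) \<le> real i"
        using K that by linarith
      then have "a ^ i * log 2 (real T) \<le> 1"
        using log_inverse_le_iff log2 by simp
      then have "real T powr (a ^ i) \<le> 2"
        using T by (simp add: log_powr flip: log_le_one_cancel_iff[of 2])
      then have "real T / 2 \<le> real T / real T powr (a ^ i)"
        using T by (intro divide_left_mono) auto
      also have "\<dots> = real T powr (1 - a ^ i)"
        using T by (simp add: powr_diff)
      finally show ?thesis
        by linarith
    qed
    have "0 \<le> (\<Sum>i\<in>{1..k}. \<lceil>real T powr (1 - a ^ i)\<rceil>)"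
      by (intro sum_nonneg) (simp add: less_le_trans[OF _ powr_ge_zero])
    moreover have "real T \<le> real_of_int (\<lceil>real T powr (1 - a ^ K)\<rceil> + \<lceil>real T powr (1 - a ^ Suc K)\<rceil>)"
      using half[of K] half[of "Suc K"] by simp
    ultimately show ?thesis
      using Suc by simp
  qed
  then show ?thesis
    using num_batches_le_if[of T a "Suc K"] K by linarith
qed

lemma num_batches_lower:
  "\<forall>\<^sub>F T :: nat in at_top.
     int (num_batches a T) \<ge> \<lfloor>log (1 / a) (ln (real T) / ln (ln (real T)))\<rfloor>"
proof -
  have C: "1 / ln (1 / a) > 0"
    using a by simp
  \<comment> \<open>The left side is a bound on the number of batches times a bound on the size of
    each. It has order \<open>ln (ln T) * T / ln T\<close>, which is o(T).\<close>
  then have "\<forall>\<^sub>F T :: nat in at_top.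
      1 / ln (1 / a) * ln (ln (real T)) * (real T / ln (real T) + 1) < real T"
    by real_asymp
  moreover have "\<forall>\<^sub>F T :: nat in at_top. ln (ln (real T)) > 1"
    by real_asymp
  moreover have "\<forall>\<^sub>F T :: nat in at_top. ln (real T) > 1"
    by real_asymp
  moreover have "\<forall>\<^sub>F T :: nat in at_top. T > 0"
    by (rule eventually_gt_at_top)
  ultimately show ?thesis
  proof eventually_elim
    case (elim T)
    let ?B = "num_batches a T" and ?R = "ln (real T) / ln (ln (real T))"
    have R_pos: "?R > 0"
      using elim by (intro divide_pos_pos) linarith+
    show ?case
    proof (rule ccontr)
      assume "\<not> ?thesis"
      \<comment> \<open>Under the negated claim, every batch index up to \<open>?B\<close> lies in
        the range where batches are small.\<close>
      then have B: "real ?B \<le> log (1 / a) ?R"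
        by linarith
      have "\<lceil>real T powr (1 - a ^ i)\<rceil> \<le> real T / ln (real T) + 1" if "i \<in> {1..?B}" for i
      proof -
        have "real i \<le> log (1 / a) ?R"
          using B that by simp
        then have "1 \<le> a ^ i * ?R"
          using le_log_inverse_iff[OF R_pos] by simp
        then have "ln (ln (real T)) \<le> a ^ i * ln (real T)"
          using elim by (simp add: field_simps)
        also have "\<dots> = ln (real T powr (a ^ i))"
          using elim by (simp add: ln_powr)
        finally have "ln (real T) \<le> real T powr (a ^ i)"
          by (subst (asm) ln_le_cancel_iff) (use elim in \<open>linarith, simp\<close>)
        then have "real T / real T powr (a ^ i) \<le> real T / ln (real T)"
          using elim by (intro divide_left_mono mult_pos_pos) (linarith | simp)+
        then have "real T powr (1 - a ^ i) \<le> real T / ln (real T)"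
          using elim by (simp add: powr_diff)
        then show ?thesis
          by linarith
      qed
      then have "(\<Sum>i\<in>{1..?B}. real_of_int \<lceil>real T powr (1 - a ^ i)\<rceil>)
          \<le> real ?B * (real T / ln (real T) + 1)"
        using sum_bounded_above[of "{1..?B}" "\<lambda>i. real_of_int \<lceil>real T powr (1 - a ^ i)\<rceil>"
            "real T / ln (real T) + 1"]
        by simp
      moreover have "real T \<le> (\<Sum>i\<in>{1..?B}. real_of_int \<lceil>real T powr (1 - a ^ i)\<rceil>)"
        using le_sum_num_batches[OF \<open>T > 0\<close>, of a]
        by (metis of_int_le_iff of_int_of_nat_eq of_int_sum)
      moreover have "real ?B \<le> 1 / ln (1 / a) * ln (ln (real T))"
      proof -
        \<comment> \<open>Dropping the denominator \<open>ln (ln T) > 1\<close> leaves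
          \<open>log (1 / a) (ln T)\<close>, whence the factor
          \<open>1 / ln (1 / a)\<close>.\<close>
        have "?R \<le> ln (real T)"
          using elim mult_left_mono[of 1 "ln (ln (real T))" "ln (real T)"]
          by (simp add: divide_le_eq)
        then have "log (1 / a) ?R \<le> log (1 / a) (ln (real T))"
          using a elim R_pos by (intro log_mono) simp_all
        then show ?thesis
          using B by (simp add: log_def)
      qed
      then have "real ?B * (real T / ln (real T) + 1)
          \<le> 1 / ln (1 / a) * ln (ln (real T)) * (real T / ln (real T) + 1)"
        using elim by (intro mult_right_mono) auto
      ultimately show False
        using elim by linarith
    qed
  qed
qed

text \<open>Both bounds are \<open>log (1 / a) (ln T)\<close> up to lower order: passing from
  \<open>log 2\<close> to \<open>ln\<close> shifts the upper one by a constant, and dividing by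
  \<open>ln (ln T)\<close> costs the lower one only a term of order \<open>ln (ln (ln T))\<close>.
  The \<open>- 1\<close> and \<open>+ 2\<close> absorb the rounding.\<close>

lemma num_batches_asymp:
  "(\<lambda>T. real (num_batches a T) / log (1 / a) (ln (real T))) \<longlonglongrightarrow> 1"
proof (rule tendsto_sandwich)
  have C: "ln (1 / a) > 0"
    using a by simp
  have pos: "\<forall>\<^sub>F T :: nat in at_top. log (1 / a) (ln (real T)) > 0"
    unfolding log_def using C by real_asymp
  show "\<forall>\<^sub>F T in at_top. (log (1 / a) (ln (real T) / ln (ln (real T))) - 1) / log (1 / a) (ln (real T))
          \<le> real (num_batches a T) / log (1 / a) (ln (real T))"
    using num_batches_lower pos
    by eventually_elim (intro divide_right_mono, linarith+)
  show "\<forall>\<^sub>F T in at_top. real (num_batches a T) / log (1 / a) (ln (real T))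
          \<le> (log (1 / a) (log 2 (real T)) + 2) / log (1 / a) (ln (real T))"
    using eventually_ge_at_top[of 2] pos
  proof eventually_elim
    case (elim T)
    have "real (num_batches a T) \<le> log (1 / a) (log 2 (real T)) + 2"
      using num_batches_upper[OF elim(1)] by linarith
    then show ?case
      using elim by (intro divide_right_mono) auto
  qed
  show "(\<lambda>T :: nat. (log (1 / a) (ln (real T) / ln (ln (real T))) - 1) / log (1 / a) (ln (real T))) \<longlonglongrightarrow> 1"
    unfolding log_def using C by real_asymp
  show "(\<lambda>T :: nat. (log (1 / a) (log 2 (real T)) + 2) / log (1 / a) (ln (real T))) \<longlonglongrightarrow> 1"
    unfolding log_def using C by real_asymp
qed

end

theorem proposition3:
  fixes a :: real
  assumes "0 < a" and "a < 1"
  shows "(\<exists>\<epsilon> :: nat \<Rightarrow> real. \<epsilon> \<in> o(\<lambda>_. 1) \<and>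
           (\<forall>\<^sub>F T in at_top. real (num_batches a T) = log (1 / a) (ln (real T)) * (1 + \<epsilon> T))) \<and>
         (\<forall>T :: nat. 2 \<le> num_batches a T \<and> num_batches a T \<le> T \<longrightarrow>
           int (num_batches a T) \<le> \<lceil>log (1 / a) (log 2 (real T))\<rceil> + 1) \<and>
         (\<forall>\<^sub>F T :: nat in at_top.
           int (num_batches a T) \<ge> \<lfloor>log (1 / a) (ln (real T) / ln (ln (real T)))\<rfloor>)"
proof (intro conjI exI allI impI)
  \<comment> \<open>The relative error is forced by the required equation wherever the logarithm is
    nonzero, hence for all large \<open>T\<close>.\<close>
  let ?\<epsilon> = "\<lambda>T. real (num_batches a T) / log (1 / a) (ln (real T)) - 1"
  show "?\<epsilon> \<in> o(\<lambda>_. 1)"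
    using tendsto_diff[OF num_batches_asymp[OF assms] tendsto_const[of 1]]
    by (intro smalloI_tendsto) simp_all
  have "ln (1 / a) > 0"
    using assms by simp
  then have "\<forall>\<^sub>F T :: nat in at_top. log (1 / a) (ln (real T)) > 0"
    unfolding log_def by real_asymp
  then show "\<forall>\<^sub>F T in at_top. real (num_batches a T) = log (1 / a) (ln (real T)) * (1 + ?\<epsilon> T)"
    by eventually_elim simp
  show "int (num_batches a T) \<le> \<lceil>log (1 / a) (log 2 (real T))\<rceil> + 1"
    if "2 \<le> num_batches a T \<and> num_batches a T \<le> T" for T
    using num_batches_upper[OF assms, of T] that by linarith
  show "\<forall>\<^sub>F T :: nat in at_top.
      int (num_batches a T) \<ge> \<lfloor>log (1 / a) (ln (real T) / ln (ln (real T)))\<rfloor>"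
    by (rule num_batches_lower[OF assms])
qed

end
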